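(* Let $f=(f_1,f_2)$ with $0<f_1,f_2<1$, $J$ a finite index set, $r_j=(r^1_j,r^2_j)\in\mathbb{R}^2$ ($j\in J$), and $J=J_1\cup J_2$ a partition. Let $\bar v_1,\dots,\bar v_4,\bar w_1,\dots,\bar w_4\ge0$ satisfy $f_1\bar v_1+f_2\bar w_1=1$, $(1-f_1)\bar v_2+f_2\bar w_2=1$, $(1-f_1)\bar v_3+(1-f_2)\bar w_3=1$, $f_1\bar v_4+(1-f_2)\bar w_4=1$, and define $\alpha_j=\max\{\alpha^1_j,\dots,\alpha^4_j\}$ with $\alpha^1_j=-r^1_j\bar v_1-r^2_j\bar w_1$, $\alpha^2_j=r^1_j\bar v_2-r^2_j\bar w_2$, $\alpha^3_j=r^1_j\bar v_3+r^2_j\bar w_3$, $\alpha^4_j=-r^1_j\bar v_4+r^2_j\bar w_4$. Define $\bar\alpha_j=\alpha_j$ for $j\in J_2$ and, for $j\in J_1$, let $\bar\alpha_j$ be the optimal value of the mixed integer program $$\begin{array}{ll}\min & \alpha_j\\ & \alpha_j-\bar v_1m^1_j-\bar w_1m^2_j\ge -r^1_j\bar v_1-r^2_j\bar w_1\\ & \alpha_j+\bar v_2m^1_j-\bar w_2m^2_j\ge r^1_j\bar v_2-r^2_j\bar w_2\\ & \alpha_j+\bar v_3m^1_j+\bar w_3m^2_j\ge r^1_j\bar v_3+r^2_j\bar w_3\\ & \alpha_j-\bar v_4m^1_j+\bar w_4m^2_j\ge -r^1_j\bar v_4+r^2_j\bar w_4\\ & m^1_j,m^2_j\in\mathbb{Z}.\end{array}$$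 Then the inequality $\sum_{j\in J}\bar\alpha_js_j\ge1$ is valid for all $s\ge0$ with $s_j\in\mathbb{Z}$ for $j\in J_1$ and $f+\sum_{j\in J}r_js_j\in\mathbb{Z}^2$ (it is a strengthening of the cut $\alpha s\ge1$).
   Context: $J_1$ indexes the nonbasic variables $s_j$ that are integer-constrained. *)

theory Defs
  imports "HOL-Analysis.Analysis"
begin

text \<open>Vectors of the plane are pairs of reals. The families \<open>v\<close> and \<open>w\<close> are only used at
  the indices 1 to 4, one for each vertex (0,0), (1,0), (1,1), (0,1) of the unit square.\<close>

definition cut_coeff :: "(nat \<Rightarrow> real) \<Rightarrow> (nat \<Rightarrow> real) \<Rightarrow> real \<times> real \<Rightarrow> real" where
  "cut_coeff v w r = Max
     {- fst r * v 1 - snd r * w 1,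
      fst r * v 2 - snd r * w 2,
      fst r * v 3 + snd r * w 3,
      - fst r * v 4 + snd r * w 4}"

definition mip_feasible ::
  "(nat \<Rightarrow> real) \<Rightarrow> (nat \<Rightarrow> real) \<Rightarrow> real \<times> real \<Rightarrow> real \<Rightarrow> int \<Rightarrow> int \<Rightarrow> bool" where
  "mip_feasible v w r a m1 m2 \<longleftrightarrow>
     a - v 1 * of_int m1 - w 1 * of_int m2 \<ge> - fst r * v 1 - snd r * w 1 \<and>
     a + v 2 * of_int m1 - w 2 * of_int m2 \<ge> fst r * v 2 - snd r * w 2 \<and>
     a + v 3 * of_int m1 + w 3 * of_int m2 \<ge> fst r * v 3 + snd r * w 3 \<and>
     a - v 4 * of_int m1 + w 4 * of_int m2 \<ge> - fst r * v 4 + snd r * w 4"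

text \<open>The optimal value is the infimum of the objective over the feasible set. For nonnegative
  \<open>v\<close> and \<open>w\<close> this is a genuine infimum: every pair of integers \<open>m1\<close>, \<open>m2\<close> extends to a
  feasible point, and the objective is at least 0 at every feasible point, because for each sign
  pattern of \<open>r - (m1, m2)\<close> one of the four constraints has the form \<open>a \<ge> c\<close> with \<open>c \<ge> 0\<close>.\<close>

definition mip_value :: "(nat \<Rightarrow> real) \<Rightarrow> (nat \<Rightarrow> real) \<Rightarrow> real \<times> real \<Rightarrow> real" where
  "mip_value v w r = Inf {a. \<exists>m1 m2. mip_feasible v w r a m1 m2}"

definition strengthened_coeff ::
  "(nat \<Rightarrow> real) \<Rightarrow> (nat \<Rightarrow> real) \<Rightarrow> ('j \<Rightarrow> real \<times> real) \<Rightarrow> 'j set \<Rightarrow> 'j \<Rightarrow> real" where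
  "strengthened_coeff v w r J1 j =
     (if j \<in> J1 then mip_value v w (r j) else cut_coeff v w (r j))"

end

theory Submission
  imports Defs
begin

text \<open>The function \<open>cut_coeff v w\<close> is sublinear, and the four normalisations make it at least 1
  on \<open>\<int> \<times> \<int> - f\<close>: each lattice point lies in one of the four quadrants spanned at the vertices of
  the unit square, and there the linear piece of that vertex is at least 1. The optimal value of the
  mixed integer program is the infimum of \<open>cut_coeff v w\<close> over the lattice translates of \<open>r j\<close>, and
  since \<open>s j\<close> is integral for \<open>j \<in> J1\<close>, replacing \<open>r j\<close> by such a translate keeps
  \<open>f + (\<Sum>j\<in>J. s j *\<^sub>R r j)\<close> in the lattice.\<close>

lemma cut_coeff_le_iff:
  "cut_coeff v w r \<le> a \<longleftrightarrow>
     - fst r * v 1 - snd r * w 1 \<le> a \<and> fst r * v 2 - snd r * w 2 \<le> a \<and>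
     fst r * v 3 + snd r * w 3 \<le> a \<and> - fst r * v 4 + snd r * w 4 \<le> a"
  by (simp add: cut_coeff_def)

lemma cut_coeff_ge:
  "- fst r * v 1 - snd r * w 1 \<le> cut_coeff v w r"
  "fst r * v 2 - snd r * w 2 \<le> cut_coeff v w r"
  "fst r * v 3 + snd r * w 3 \<le> cut_coeff v w r"
  "- fst r * v 4 + snd r * w 4 \<le> cut_coeff v w r"
  using cut_coeff_le_iff[of v w r "cut_coeff v w r"] by blast+

lemma cut_coeff_zero: "cut_coeff v w 0 = 0"
  by (simp add: cut_coeff_def)

lemma cut_coeff_add: "cut_coeff v w (x + y) \<le> cut_coeff v w x + cut_coeff v w y"
  unfolding cut_coeff_le_iff[of v w "x + y"] fst_add snd_add
  using cut_coeff_ge[where v = v and w = w and r = x] cut_coeff_ge[where v = v and w = w and r = y]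
  by (simp add: algebra_simps)

lemma cut_coeff_scaleR_le:
  assumes "0 \<le> c"
  shows "cut_coeff v w (c *\<^sub>R x) \<le> cut_coeff v w x * c"
  unfolding cut_coeff_le_iff[of v w "c *\<^sub>R x"]
  using cut_coeff_ge[where v = v and w = w and r = x, THEN mult_right_mono, OF assms]
  by (simp add: algebra_simps)

lemma cut_coeff_sum_le:
  assumes "\<And>j. j \<in> J \<Longrightarrow> 0 \<le> s j"
  shows "cut_coeff v w (\<Sum>j\<in>J. s j *\<^sub>R x j) \<le> (\<Sum>j\<in>J. cut_coeff v w (x j) * s j)"
  using assms
proof (induction J rule: infinite_finite_induct)
  case (insert j J)
  have "cut_coeff v w (\<Sum>j\<in>insert j J. s j *\<^sub>R x j)
      \<le> cut_coeff v w (s j *\<^sub>R x j) + cut_coeff v w (\<Sum>j\<in>J. s j *\<^sub>R x j)"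
    using insert.hyps by (simp add: cut_coeff_add)
  also have "\<dots> \<le> cut_coeff v w (x j) * s j + (\<Sum>j\<in>J. cut_coeff v w (x j) * s j)"
    using insert.IH insert.prems by (intro add_mono cut_coeff_scaleR_le) auto
  finally show ?case
    using insert.hyps by simp
\<comment> \<open>For infinite \<open>J\<close> both sums are 0 by convention, so this case
  coincides with the empty one.\<close>
qed (simp_all add: cut_coeff_zero)

text \<open>On each closed quadrant one of the four linear pieces is a sum of two nonnegative
  products. This bounds the objective of the integer program from below.\<close>

lemma cut_coeff_nonneg:
  assumes v: "\<And>i. i \<in> {1..4} \<Longrightarrow> 0 \<le> v i" and w: "\<And>i. i \<in> {1..4} \<Longrightarrow> 0 \<le> w i"
  shows "0 \<le> cut_coeff v w r"
proof -
  have vw: "0 \<le> v 1" "0 \<le> v 2" "0 \<le> v 3" "0 \<le> v 4" "0 \<le> w 1" "0 \<le> w 2" "0 \<le> w 3" "0 \<le> w 4"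
    by (auto intro!: v w)
  consider "fst r \<le> 0" "snd r \<le> 0" | "0 \<le> fst r" "snd r \<le> 0"
    | "0 \<le> fst r" "0 \<le> snd r" | "fst r \<le> 0" "0 \<le> snd r"
    by linarith
  then show ?thesis
  proof cases
    case 1
    then have "fst r * v 1 \<le> 0" "snd r * w 1 \<le> 0"
      by (simp_all add: mult_nonpos_nonneg vw del: One_nat_def)
    with cut_coeff_ge(1)[of r v w] show ?thesis by linarith
  next
    case 2
    then have "0 \<le> fst r * v 2" "snd r * w 2 \<le> 0"
      by (simp_all add: mult_nonpos_nonneg vw)
    with cut_coeff_ge(2)[of r v w] show ?thesis by linarith
  next
    case 3
    then have "0 \<le> fst r * v 3" "0 \<le> snd r * w 3"
      by (simp_all add: vw)
    with cut_coeff_ge(3)[of r v w] show ?thesis by linarith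
  next
    case 4
    then have "fst r * v 4 \<le> 0" "0 \<le> snd r * w 4"
      by (simp_all add: mult_nonpos_nonneg vw)
    with cut_coeff_ge(4)[of r v w] show ?thesis by linarith
  qed
qed

lemma cut_coeff_lattice_ge_1:
  assumes v: "\<And>i. i \<in> {1..4} \<Longrightarrow> 0 \<le> v i" and w: "\<And>i. i \<in> {1..4} \<Longrightarrow> 0 \<le> w i"
    and n1: "fst f * v 1 + snd f * w 1 = 1"
    and n2: "(1 - fst f) * v 2 + snd f * w 2 = 1"
    and n3: "(1 - fst f) * v 3 + (1 - snd f) * w 3 = 1"
    and n4: "fst f * v 4 + (1 - snd f) * w 4 = 1"
    and lattice: "f + x \<in> \<int> \<times> \<int>"
  shows "1 \<le> cut_coeff v w x"
proof -
  have vw: "0 \<le> v 1" "0 \<le> v 2" "0 \<le> v 3" "0 \<le> v 4" "0 \<le> w 1" "0 \<le> w 2" "0 \<le> w 3" "0 \<le> w 4"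
    by (auto intro!: v w)
  obtain p q where "fst f + fst x = of_int p" "snd f + snd x = of_int q"
    using lattice by (auto simp: mem_Times_iff elim!: Ints_cases)
  \<comment> \<open>No integer lies strictly between 0 and 1, so each coordinate of
    \<open>f + x\<close> falls on one of two sides of the unit square.\<close>
  moreover have "p \<le> 0 \<or> 1 \<le> p" "q \<le> 0 \<or> 1 \<le> q"
    by auto
  ultimately have cases: "fst f \<le> - fst x \<or> 1 - fst f \<le> fst x"
      "snd f \<le> - snd x \<or> 1 - snd f \<le> snd x"
    by linarith+
  from cases consider "fst f \<le> - fst x" "snd f \<le> - snd x" | "1 - fst f \<le> fst x" "snd f \<le> - snd x"
    | "1 - fst f \<le> fst x" "1 - snd f \<le> snd x" | "fst f \<le> - fst x" "1 - snd f \<le> snd x"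
    by blast
  then show ?thesis
  proof cases
    case 1
    \<comment> \<open>Weighting the two coordinate bounds by \<open>v 1\<close> and
      \<open>w 1\<close> and adding them bounds the first piece at \<open>x\<close> from below by
      the left side of \<open>n1\<close>. The other cases follow the same pattern.\<close>
    with n1 cut_coeff_ge(1)[of x v w] show ?thesis
      using mult_right_mono[OF 1(1) vw(1)] mult_right_mono[OF 1(2) vw(5)] by linarith
  next
    case 2
    with n2 cut_coeff_ge(2)[of x v w] show ?thesis
      using mult_right_mono[OF 2(1) vw(2)] mult_right_mono[OF 2(2) vw(6)] by linarith
  next
    case 3
    with n3 cut_coeff_ge(3)[of x v w] show ?thesis
      using mult_right_mono[OF 3(1) vw(3)] mult_right_mono[OF 3(2) vw(7)] by linarith
  next
    case 4
    with n4 cut_coeff_ge(4)[of x v w] show ?thesis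
      using mult_right_mono[OF 4(1) vw(4)] mult_right_mono[OF 4(2) vw(8)] by linarith
  qed
qed

text \<open>Once the integer terms are moved to the right, the constraints are the four pieces of
  the maximum evaluated at a lattice translate of \<open>r\<close>.\<close>

lemma mip_feasible_iff_cut_coeff_le:
  "mip_feasible v w r a m1 m2 \<longleftrightarrow> cut_coeff v w (r - (of_int m1, of_int m2)) \<le> a"
  unfolding mip_feasible_def cut_coeff_le_iff by (simp add: algebra_simps)

text \<open>The zero translate is feasible with objective \<open>cut_coeff v w r\<close>;
  nonnegativity of the objective makes the infimum a true lower bound.\<close>

lemma mip_value_le_cut_coeff:
  assumes "\<And>i. i \<in> {1..4} \<Longrightarrow> 0 \<le> v i" and "\<And>i. i \<in> {1..4} \<Longrightarrow> 0 \<le> w i"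
  shows "mip_value v w r \<le> cut_coeff v w r"
  unfolding mip_value_def mip_feasible_iff_cut_coeff_le
proof (rule cInf_lower)
  show "cut_coeff v w r \<in> {a. \<exists>m1 m2. cut_coeff v w (r - (of_int m1, of_int m2)) \<le> a}"
    by (auto intro!: exI[of _ 0] simp flip: zero_prod_def)
  show "bdd_below {a. \<exists>m1 m2. cut_coeff v w (r - (of_int m1, of_int m2)) \<le> a}"
    using order_trans[OF cut_coeff_nonneg[of v w, OF assms]] by (intro bdd_belowI[of _ 0]) blast
qed

text \<open>Near-optimal translates stand in for minimisers, since the infimum is not shown to be
  attained.\<close>

lemma mip_value_approx:
  assumes "0 < e"
  shows "\<exists>m \<in> \<int> \<times> \<int>. cut_coeff v w (r - m) < mip_value v w r + e"
proof -
  have "cut_coeff v w (r - (of_int 0, of_int 0))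
      \<in> {a. \<exists>m1 m2. cut_coeff v w (r - (of_int m1, of_int m2)) \<le> a}"
    by blast
  then have "{a. \<exists>m1 m2. cut_coeff v w (r - (of_int m1, of_int m2)) \<le> a} \<noteq> {}"
    by blast
  from cInf_lessD[OF this, of "mip_value v w r + e"] obtain a m1 m2
    where "cut_coeff v w (r - (of_int m1, of_int m2)) \<le> a" "a < mip_value v w r + e"
    using assms by (auto simp: mip_value_def mip_feasible_iff_cut_coeff_le)
  then show ?thesis
    by (intro bexI[of _ "(of_int m1, of_int m2)"]) auto
qed

text \<open>Taking \<open>m = 0\<close> outside \<open>J1\<close> lets the main argument treat
  integral and continuous variables alike.\<close>

lemma strengthened_coeff_approx:
  assumes "0 < e"
  shows "\<exists>m \<in> \<int> \<times> \<int>. (j \<notin> J1 \<longrightarrow> m = 0) \<and>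
    cut_coeff v w (r j - m) \<le> strengthened_coeff v w r J1 j + e"
proof (cases "j \<in> J1")
  case True
  obtain m where "m \<in> \<int> \<times> \<int>" "cut_coeff v w (r j - m) < mip_value v w (r j) + e"
    using mip_value_approx[OF assms] by blast
  with True show ?thesis
    by (intro bexI[of _ m]) (simp_all add: strengthened_coeff_def)
next
  case False
  then show ?thesis
    using assms by (intro bexI[of _ 0]) (auto simp: strengthened_coeff_def mem_Times_iff)
qed

lemma sum_scaleR_lattice:
  fixes m :: "'j \<Rightarrow> real \<times> real"
  assumes "\<And>j. j \<in> J \<Longrightarrow> m j \<in> \<int> \<times> \<int> \<and> (s j \<in> \<int> \<or> m j = 0)"
  shows "(\<Sum>j\<in>J. s j *\<^sub>R m j) \<in> \<int> \<times> \<int>"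
proof -
  have "s j * fst (m j) \<in> \<int> \<and> s j * snd (m j) \<in> \<int>" if "j \<in> J" for j
    using assms[OF that] by (auto simp: mem_Times_iff)
  then show ?thesis
    by (simp add: mem_Times_iff fst_sum snd_sum Ints_sum)
qed

theorem theorem6p2:
  fixes f :: "real \<times> real" and J J1 J2 :: "'j set" and r :: "'j \<Rightarrow> real \<times> real"
    and v w :: "nat \<Rightarrow> real"
  assumes "0 < fst f" "fst f < 1" "0 < snd f" "snd f < 1"
    and "finite J" and "J = J1 \<union> J2" and "J1 \<inter> J2 = {}"
    and "\<And>i. i \<in> {1..4} \<Longrightarrow> 0 \<le> v i" and "\<And>i. i \<in> {1..4} \<Longrightarrow> 0 \<le> w i"
    and "fst f * v 1 + snd f * w 1 = 1"
    and "(1 - fst f) * v 2 + snd f * w 2 = 1"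
    and "(1 - fst f) * v 3 + (1 - snd f) * w 3 = 1"
    and "fst f * v 4 + (1 - snd f) * w 4 = 1"
  shows "(\<forall>s :: 'j \<Rightarrow> real.
            (\<forall>j\<in>J. 0 \<le> s j) \<and> (\<forall>j\<in>J1. s j \<in> \<int>) \<and>
            f + (\<Sum>j\<in>J. s j *\<^sub>R r j) \<in> \<int> \<times> \<int> \<longrightarrow>
            (\<Sum>j\<in>J. strengthened_coeff v w r J1 j * s j) \<ge> 1) \<and>
         (\<forall>j\<in>J. strengthened_coeff v w r J1 j \<le> cut_coeff v w (r j))"
proof (intro conjI allI impI ballI)
  fix j
  show "strengthened_coeff v w r J1 j \<le> cut_coeff v w (r j)"
    using mip_value_le_cut_coeff[of v w "r j", OF assms(8,9)] by (simp add: strengthened_coeff_def)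
next
  fix s :: "'j \<Rightarrow> real"
  assume s: "(\<forall>j\<in>J. 0 \<le> s j) \<and> (\<forall>j\<in>J1. s j \<in> \<int>) \<and> f + (\<Sum>j\<in>J. s j *\<^sub>R r j) \<in> \<int> \<times> \<int>"
  \<comment> \<open>An error \<open>e\<close> in every coefficient changes the left side of the cut
    by \<open>e * S\<close>.\<close>
  define S where "S = (\<Sum>j\<in>J. s j)"
  have "0 \<le> S"
    using s by (auto simp: S_def intro: sum_nonneg)
  have approx: "1 \<le> (\<Sum>j\<in>J. strengthened_coeff v w r J1 j * s j) + e * S" if e: "0 < e" for e
  proof -
    have "\<forall>j. \<exists>m. m \<in> \<int> \<times> \<int> \<and> (j \<notin> J1 \<longrightarrow> m = 0) \<and>
        cut_coeff v w (r j - m) \<le> strengthened_coeff v w r J1 j + e"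
      using strengthened_coeff_approx[OF e, of _ J1 v w r] by (simp only: Bex_def) iprover
    from choice[OF this] obtain m where m: "\<And>j. m j \<in> \<int> \<times> \<int>" "\<And>j. j \<notin> J1 \<Longrightarrow> m j = 0"
      "\<And>j. cut_coeff v w (r j - m j) \<le> strengthened_coeff v w r J1 j + e"
      by iprover
    have "(\<Sum>j\<in>J. s j *\<^sub>R m j) \<in> \<int> \<times> \<int>"
      using m s by (intro sum_scaleR_lattice) blast
    \<comment> \<open>Subtracting a lattice vector replaces every \<open>r j\<close> by its
      near-optimal translate while staying in the lattice, so the bound 1 for
      \<open>cut_coeff\<close> applies to the translated rays.\<close>
    with s have "(f + (\<Sum>j\<in>J. s j *\<^sub>R r j)) - (\<Sum>j\<in>J. s j *\<^sub>R m j) \<in> \<int> \<times> \<int>"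
      by (simp add: mem_Times_iff)
    then have "f + (\<Sum>j\<in>J. s j *\<^sub>R (r j - m j)) \<in> \<int> \<times> \<int>"
      by (simp add: scaleR_diff_right sum_subtractf add_diff_eq)
    from cut_coeff_lattice_ge_1[of v w, OF assms(8,9) assms(10-13) this]
    have "1 \<le> cut_coeff v w (\<Sum>j\<in>J. s j *\<^sub>R (r j - m j))"
      by blast
    also have "\<dots> \<le> (\<Sum>j\<in>J. cut_coeff v w (r j - m j) * s j)"
      using s by (intro cut_coeff_sum_le) blast
    also have "\<dots> \<le> (\<Sum>j\<in>J. (strengthened_coeff v w r J1 j + e) * s j)"
      using s m(3) by (intro sum_mono mult_right_mono) auto
    also have "\<dots> = (\<Sum>j\<in>J. strengthened_coeff v w r J1 j * s j) + e * S"
      by (simp add: S_def distrib_right sum.distrib sum_distrib_left)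
    finally show ?thesis .
  qed
  show "1 \<le> (\<Sum>j\<in>J. strengthened_coeff v w r J1 j * s j)"
  proof (rule field_le_epsilon)
    fix e :: real
    assume "0 < e"
    \<comment> \<open>The divisor \<open>S + 1\<close> is positive given only
      \<open>0 \<le> S\<close>, and it scales the total error down to at most
      \<open>e\<close>.\<close>
    with \<open>0 \<le> S\<close> have "0 < e / (S + 1)" "e / (S + 1) * S \<le> e"
      by (auto simp: field_simps)
    with approx[of "e / (S + 1)"] show "1 \<le> (\<Sum>j\<in>J. strengthened_coeff v w r J1 j * s j) + e"
      by linarith
  qed
qed

end
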